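(* A linear order $L$ is cyclically transitive if and only if the associated cyclic order $\check L$ is transitive.
   Context: Linear orders may be empty. $L_1+L_2$ denotes the ordered sum (every element of $L_1$ strictly below every element of $L_2$); a partition $L=L_1+L_2$ means that $L_1$ is an initial segment of $L$ and $L_2$ is its complement (either may be empty). $L$ is cyclically transitive if for any $a\le b$ in $L$ there exist partitions $L=L_1+L_2=L_2'+L_1'$ with $a\in L_1$, $b\in L_1'$, and order isomorphisms $F_1:L_1\to L_1'$, $F_2:L_2\to L_2'$ satisfying $F_1(a)=b$. A cyclic ordering is a pair $(X,R)$ with $R$ a ternary relation on the set $X$ such that (i) for all $x,y,z\in X$, $R(x,y,z)\iff R(y,z,x)\iff R(z,x,y)$; (ii) for every $a\in X$, the relation $<_a$ on $X\setminus\{a\}$ defined by $x<_a y\iff R(a,x,y)$ is a strict linear order. An automorphism of $(X,R)$ is a bijection $\phi:X\to X$ with $R(x,y,z)\iff R(\phi(x),\phi(y),\phi(z))$ for all $x,y,z\in X$. $(X,R)$ is transitive if for any $a,b\in X$ there is an automorphism $\phi$ of $(X,R)$ with $\phi(a)=b$. For a linear order $L$, $\check L:=(L,R)$ is the cyclic order where $R(a,b,c)$ holds if and only if one of $a<b<c$, $b<c<a$, $c<a<b$ holds. *)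

theory Defs
  imports Main
begin

text \<open>
  A linear order is a reflexive relation \<open>L\<close> with \<open>Linear_order L\<close>; its underlying set is
  \<open>Field L\<close>, and the empty order is \<open>L = {}\<close>. The order induced on \<open>A \<subseteq> Field L\<close> is
  \<open>Restr L A\<close>, and order isomorphisms are expressed by \<open>iso\<close>. The latter is defined in the
  library through \<open>embed\<close> with well-orders in mind, but by \<open>iso_iff2\<close> it means for arbitrary
  relations a bijection between the fields that preserves and reflects the relation.
\<close>

text \<open>The partition \<open>L = A + B\<close>; \<open>ofilter L A\<close> says that \<open>A\<close> is an initial segment of \<open>L\<close>.\<close>

definition ordered_partition :: "'a rel \<Rightarrow> 'a set \<Rightarrow> 'a set \<Rightarrow> bool" where
  "ordered_partition L A B \<longleftrightarrow> ofilter L A \<and> B = Field L - A"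

text \<open>The expected field: without reflexivity of \<open>L\<close> this could fail for singletons.\<close>

lemma Field_Restr_Linear_order:
  assumes "Linear_order L" and "A \<subseteq> Field L"
  shows "Field (Restr L A) = A"
  using assms by (auto simp: order_on_defs refl_on_def Field_def)

definition cyclically_transitive :: "'a rel \<Rightarrow> bool" where
  "cyclically_transitive L \<longleftrightarrow>
    (\<forall>a b. (a, b) \<in> L \<longrightarrow>
      (\<exists>L1 L2 L1' L2' F1 F2.
        ordered_partition L L1 L2 \<and> ordered_partition L L2' L1' \<and>
        a \<in> L1 \<and> b \<in> L1' \<and>
        iso (Restr L L1) (Restr L L1') F1 \<and>
        iso (Restr L L2) (Restr L L2') F2 \<and>
        F1 a = b))"

text \<open>The first conjunct says that \<open>R\<close> is a relation on \<open>X\<close>.\<close>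

definition cyclic_ordering :: "'a set \<Rightarrow> ('a \<Rightarrow> 'a \<Rightarrow> 'a \<Rightarrow> bool) \<Rightarrow> bool" where
  "cyclic_ordering X R \<longleftrightarrow>
    (\<forall>x y z. R x y z \<longrightarrow> x \<in> X \<and> y \<in> X \<and> z \<in> X) \<and>
    (\<forall>x\<in>X. \<forall>y\<in>X. \<forall>z\<in>X. (R x y z \<longleftrightarrow> R y z x) \<and> (R y z x \<longleftrightarrow> R z x y)) \<and>
    (\<forall>a\<in>X. strict_linear_order_on (X - {a})
        {(x, y). x \<in> X - {a} \<and> y \<in> X - {a} \<and> R a x y})"

definition cyclic_automorphism ::
    "'a set \<Rightarrow> ('a \<Rightarrow> 'a \<Rightarrow> 'a \<Rightarrow> bool) \<Rightarrow> ('a \<Rightarrow> 'a) \<Rightarrow> bool" where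
  "cyclic_automorphism X R \<phi> \<longleftrightarrow>
    bij_betw \<phi> X X \<and>
    (\<forall>x\<in>X. \<forall>y\<in>X. \<forall>z\<in>X. R x y z \<longleftrightarrow> R (\<phi> x) (\<phi> y) (\<phi> z))"

definition transitive_cyclic_order :: "'a set \<Rightarrow> ('a \<Rightarrow> 'a \<Rightarrow> 'a \<Rightarrow> bool) \<Rightarrow> bool" where
  "transitive_cyclic_order X R \<longleftrightarrow>
    (\<forall>a\<in>X. \<forall>b\<in>X. \<exists>\<phi>. cyclic_automorphism X R \<phi> \<and> \<phi> a = b)"

text \<open>The ternary relation of the cyclic order associated with \<open>L\<close>; \<open>L - Id\<close> is the strict
  part of \<open>L\<close>.\<close>

definition cyclic_rel :: "'a rel \<Rightarrow> 'a \<Rightarrow> 'a \<Rightarrow> 'a \<Rightarrow> bool" where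
  "cyclic_rel L a b c \<longleftrightarrow>
    ((a, b) \<in> L - Id \<and> (b, c) \<in> L - Id) \<or>
    ((b, c) \<in> L - Id \<and> (c, a) \<in> L - Id) \<or>
    ((c, a) \<in> L - Id \<and> (a, b) \<in> L - Id)"

lemma cyclic_ordering_cyclic_rel:
  assumes "Linear_order L"
  shows "cyclic_ordering (Field L) (cyclic_rel L)"
proof -
  have tr: "\<And>x y z. (x, y) \<in> L \<Longrightarrow> (y, z) \<in> L \<Longrightarrow> (x, z) \<in> L"
    and an: "\<And>x y. (x, y) \<in> L \<Longrightarrow> (y, x) \<in> L \<Longrightarrow> x = y"
    and tot: "\<And>x y. x \<in> Field L \<Longrightarrow> y \<in> Field L \<Longrightarrow> x \<noteq> y \<Longrightarrow> (x, y) \<in> L \<or> (y, x) \<in> L"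
    using assms by (auto simp: order_on_defs total_on_def dest: transD antisymD)
  have "strict_linear_order_on (Field L - {a})
      {(x, y). x \<in> Field L - {a} \<and> y \<in> Field L - {a} \<and> cyclic_rel L a x y}"
    if "a \<in> Field L" for a
    unfolding strict_linear_order_on_def
  proof (intro conjI)
    show "trans {(x, y). x \<in> Field L - {a} \<and> y \<in> Field L - {a} \<and> cyclic_rel L a x y}"
      unfolding trans_def cyclic_rel_def by (auto dest: tr an)
    show "irrefl {(x, y). x \<in> Field L - {a} \<and> y \<in> Field L - {a} \<and> cyclic_rel L a x y}"
      unfolding irrefl_def cyclic_rel_def by (auto dest: an)
    show "total_on (Field L - {a})
        {(x, y). x \<in> Field L - {a} \<and> y \<in> Field L - {a} \<and> cyclic_rel L a x y}"
      unfolding total_on_def cyclic_rel_def using tot that by (auto; metis)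
  qed
  then show ?thesis
    unfolding cyclic_ordering_def by (auto simp: cyclic_rel_def intro: FieldI1 FieldI2)
qed

end

theory Submission
  imports Defs
begin

text \<open>
  Gluing the two isomorphisms of a rotation \<open>L1 + L2 = L2' + L1'\<close> gives an automorphism of the
  cyclic order. Conversely, for an automorphism \<open>\<phi>\<close> the set \<open>B\<close> of all \<open>y\<close> with
  \<open>\<phi> y < \<phi> x\<close> for some \<open>x < y\<close> is a final segment, \<open>\<phi>\<close> is monotone on \<open>B\<close> and on its
  complement \<open>A\<close>, and \<open>L = A + B = \<phi> B + \<phi> A\<close>. If \<open>a \<in> A\<close>, this is the required rotation.
  If \<open>a \<in> B\<close>, then \<open>a \<le> b = \<phi> a\<close> makes \<open>\<phi>\<close> an isomorphism of \<open>[a, \<infinity>)\<close> onto an initial segment of its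
  own final segment \<open>[b, \<infinity>)\<close>, so the two are isomorphic by Lindenbaum's ordered version of the
  Cantor-Bernstein theorem. Dually \<open>(-\<infinity>, a]\<close> and \<open>(-\<infinity>, b]\<close> are isomorphic, so that some
  automorphism of \<open>L\<close> itself maps \<open>a\<close> to \<open>b\<close>.
\<close>

section \<open>Preliminaries on linear orders, induced orders and inverse automorphisms\<close>

lemma Linear_order_facts:
  assumes "Linear_order L"
  shows Linear_order_refl: "x \<in> Field L \<Longrightarrow> (x, x) \<in> L"
    and Linear_order_trans: "(x, y) \<in> L \<Longrightarrow> (y, z) \<in> L \<Longrightarrow> (x, z) \<in> L"
    and Linear_order_antisym: "(x, y) \<in> L \<Longrightarrow> (y, x) \<in> L \<Longrightarrow> x = y"
    and Linear_order_total: "x \<in> Field L \<Longrightarrow> y \<in> Field L \<Longrightarrow> (x, y) \<in> L \<or> (y, x) \<in> L"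
proof -
  have "refl_on (Field L) L" "trans L" "antisym L" "total_on (Field L) L"
    using assms by (auto simp: order_on_defs)
  then show "x \<in> Field L \<Longrightarrow> (x, x) \<in> L"
    and "(x, y) \<in> L \<Longrightarrow> (y, z) \<in> L \<Longrightarrow> (x, z) \<in> L"
    and "(x, y) \<in> L \<Longrightarrow> (y, x) \<in> L \<Longrightarrow> x = y"
    and "x \<in> Field L \<Longrightarrow> y \<in> Field L \<Longrightarrow> (x, y) \<in> L \<or> (y, x) \<in> L"
    by (metis refl_onD, metis transD, metis antisymD, metis total_on_def refl_onD)
qed

text \<open>A monotone bijection between linear orders reflects the order as well: if
  \<open>x\<close> were not below \<open>y\<close>, totality and monotonicity would give
  \<open>f y\<close> below \<open>f x\<close>, so that antisymmetry and injectivity force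
  \<open>x = y\<close>.\<close>

lemma iso_Restr_iff:
  assumes "Linear_order L" and "A \<subseteq> Field L" and "B \<subseteq> Field L"
  shows "iso (Restr L A) (Restr L B) f \<longleftrightarrow>
    bij_betw f A B \<and> (\<forall>x\<in>A. \<forall>y\<in>A. (x, y) \<in> L \<longrightarrow> (f x, f y) \<in> L)"
    (is "_ \<longleftrightarrow> ?R")
proof
  assume "iso (Restr L A) (Restr L B) f"
  then show ?R
    unfolding iso_iff2 using assms by (auto simp: Field_Restr_Linear_order)
next
  assume R: ?R
  have refl: "(x, y) \<in> L" if "x \<in> A" "y \<in> A" "(f x, f y) \<in> L" for x y
  proof (rule ccontr)
    assume n: "(x, y) \<notin> L"
    then have yx: "(y, x) \<in> L"
      using that assms Linear_order_total[OF assms(1)] by blast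
    then have "f x = f y"
      using that R Linear_order_antisym[OF assms(1)] by blast
    then have "x = y" using R that by (auto simp: bij_betw_def inj_on_def)
    with n yx show False by simp
  qed
  show "iso (Restr L A) (Restr L B) f"
    unfolding iso_iff2 using assms R refl
    by (auto simp: Field_Restr_Linear_order bij_betw_apply)
qed

text \<open>Rotations are only provided for \<open>a\<close> below \<open>b\<close>; inverses supply
  the automorphisms that move a point downwards.\<close>

lemma cyclic_automorphism_inv_into:
  assumes "cyclic_automorphism X R \<phi>"
  shows "cyclic_automorphism X R (inv_into X \<phi>)"
proof -
  have b: "bij_betw \<phi> X X" and R: "\<And>x y z. x \<in> X \<Longrightarrow> y \<in> X \<Longrightarrow> z \<in> X \<Longrightarrow>
      R x y z = R (\<phi> x) (\<phi> y) (\<phi> z)"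
    using assms unfolding cyclic_automorphism_def by auto
  have i: "bij_betw (inv_into X \<phi>) X X" using b by (rule bij_betw_inv_into)
  have "R x y z = R (inv_into X \<phi> x) (inv_into X \<phi> y) (inv_into X \<phi> z)"
    if "x \<in> X" "y \<in> X" "z \<in> X" for x y z
    using R[of "inv_into X \<phi> x" "inv_into X \<phi> y" "inv_into X \<phi> z"] that
    by (simp add: bij_betw_apply[OF i] bij_betw_inv_into_right[OF b])
  with i show ?thesis unfolding cyclic_automorphism_def by blast
qed

section \<open>Rotations as cyclic automorphisms\<close>

lemma ordered_partition_props:
  assumes L: "Linear_order L" and "ordered_partition L A B"
  shows "A \<union> B = Field L" and "A \<inter> B = {}"
    and "x \<in> A \<Longrightarrow> y \<in> B \<Longrightarrow> (x, y) \<in> L - Id" and "x \<in> A \<Longrightarrow> y \<in> B \<Longrightarrow> (y, x) \<notin> L"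
proof -
  have *: "A \<subseteq> Field L" "B = Field L - A" "\<And>x y. x \<in> A \<Longrightarrow> (y, x) \<in> L \<Longrightarrow> y \<in> A"
    using assms(2) unfolding ordered_partition_def ofilter_def under_def by auto
  show "A \<union> B = Field L" "A \<inter> B = {}" using * by auto
  show n: "(y, x) \<notin> L" if "x \<in> A" "y \<in> B" using * that by blast
  show "(x, y) \<in> L - Id" if "x \<in> A" "y \<in> B"
    using * that n[OF that] Linear_order_total[OF L, of x y] by blast
qed

text \<open>The glued map keeps the order inside each block and reverses it between the blocks. A
  triple that meets both blocks has exactly two points in one of them, and its cyclic relation
  depends only on how these two compare, so the swap of the blocks is invisible.\<close>

lemma cyclic_automorphism_rotation:
  assumes L: "Linear_order L"
    and p: "ordered_partition L A B" and q: "ordered_partition L B' A'"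
    and f: "iso (Restr L A) (Restr L A') f" and g: "iso (Restr L B) (Restr L B') g"
  shows "cyclic_automorphism (Field L) (cyclic_rel L) (\<lambda>x. if x \<in> A then f x else g x)"
proof -
  define h where "h x = (if x \<in> A then f x else g x)" for x
  define lt where "lt x y \<longleftrightarrow> (x, y) \<in> L - Id" for x y
  note P = ordered_partition_props[OF L p] and Q = ordered_partition_props[OF L q]
  have sub: "A \<subseteq> Field L" "B \<subseteq> Field L" "A' \<subseteq> Field L" "B' \<subseteq> Field L" using P(1) Q(1) by auto
  have fb: "bij_betw f A A'" and gb: "bij_betw g B B'"
    using f g sub L by (auto simp: iso_Restr_iff)
  have hA: "h x = f x" if "x \<in> A" for x using that unfolding h_def by simp
  have hB: "h x = g x" if "x \<in> B" for x using that P(2) unfolding h_def by auto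
  have lt_A: "lt (h x) (h y) \<longleftrightarrow> lt x y" if "x \<in> A" "y \<in> A" for x y
    using f that sub L fb unfolding iso_iff2 lt_def
    by (auto simp: Field_Restr_Linear_order bij_betw_def inj_on_def hA)
  have lt_B: "lt (h x) (h y) \<longleftrightarrow> lt x y" if "x \<in> B" "y \<in> B" for x y
    using g that sub L gb unfolding iso_iff2 lt_def
    by (auto simp: Field_Restr_Linear_order bij_betw_def inj_on_def hB)
  \<comment> \<open>The reversal comes from the target partition, where \<open>B'\<close>, the image
    of \<open>B\<close>, precedes \<open>A'\<close>.\<close>
  have lt_AB: "lt x y" "\<not> lt y x" "lt (h y) (h x)" "\<not> lt (h x) (h y)"
    if "x \<in> A" "y \<in> B" for x y
    using P(3,4)[OF that] Q(3,4)[of "g y" "f x"] bij_betw_apply[OF fb that(1)]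
      bij_betw_apply[OF gb that(2)] hA[OF that(1)] hB[OF that(2)] unfolding lt_def by auto
  have "bij_betw h A A'" using fb hA by (simp cong: bij_betw_cong)
  moreover have "bij_betw h B B'" using gb hB by (simp cong: bij_betw_cong)
  ultimately have "bij_betw h (A \<union> B) (A' \<union> B')"
    using Q(2) by (intro bij_betw_combine) auto
  then have bij: "bij_betw h (Field L) (Field L)" using P(1) Q(1) by (simp add: Un_commute)
  have "cyclic_rel L x y z \<longleftrightarrow> cyclic_rel L (h x) (h y) (h z)"
    if "x \<in> Field L" "y \<in> Field L" "z \<in> Field L" for x y z
  proof -
    have "x \<in> A \<or> x \<in> B" "y \<in> A \<or> y \<in> B" "z \<in> A \<or> z \<in> B" using that P(1) by auto
    then show ?thesis
      unfolding cyclic_rel_def lt_def[symmetric]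
      by (elim disjE) (simp_all add: lt_A lt_B lt_AB)
  qed
  with bij have "cyclic_automorphism (Field L) (cyclic_rel L) h"
    unfolding cyclic_automorphism_def by blast
  then show ?thesis unfolding h_def .
qed

section \<open>Cutting the order along a cyclic automorphism\<close>

lemma cyclic_automorphism_cut:
  assumes L: "Linear_order L" and phi: "cyclic_automorphism (Field L) (cyclic_rel L) \<phi>"
  obtains A B where "ordered_partition L A B" and "ordered_partition L (\<phi> ` B) (\<phi> ` A)"
    and "iso (Restr L A) (Restr L (\<phi> ` A)) \<phi>" and "iso (Restr L B) (Restr L (\<phi> ` B)) \<phi>"
proof -
  define lt where "lt x y \<longleftrightarrow> (x, y) \<in> L - Id" for x y
  define B where "B = {y \<in> Field L. \<exists>x. lt x y \<and> lt (\<phi> y) (\<phi> x)}"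
  define A where "A = Field L - B"
  have AF: "A \<subseteq> Field L" and BF: "B \<subseteq> Field L" unfolding A_def B_def by auto
  have fld: "x \<in> Field L" "y \<in> Field L" if "lt x y" for x y
    using that unfolding lt_def by (auto intro: FieldI1 FieldI2)
  have tr: "lt x z" if "lt x y" "lt y z" for x y z
    using that Linear_order_trans[OF L] Linear_order_antisym[OF L] unfolding lt_def by blast
  have irr: "\<not> lt x x" for x unfolding lt_def by simp
  have asym: "\<not> lt y x" if "lt x y" for x y using tr irr that by blast
  have tot: "lt x y \<or> x = y \<or> lt y x" if "x \<in> Field L" "y \<in> Field L" for x y
    using that Linear_order_total[OF L] unfolding lt_def by blast
  have bij: "bij_betw \<phi> (Field L) (Field L)" using phi unfolding cyclic_automorphism_def by blast
  have inj: "x = y" if "\<phi> x = \<phi> y" "x \<in> Field L" "y \<in> Field L" for x y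
    using bij that unfolding bij_betw_def inj_on_def by blast
  have phiF: "\<phi> x \<in> Field L" if "x \<in> Field L" for x using bij that by (rule bij_betw_apply)
  have cyc: "lt (\<phi> x) (\<phi> y) \<and> lt (\<phi> y) (\<phi> z) \<or> lt (\<phi> y) (\<phi> z) \<and> lt (\<phi> z) (\<phi> x)
      \<or> lt (\<phi> z) (\<phi> x) \<and> lt (\<phi> x) (\<phi> y)" if "lt x y" "lt y z" for x y z
  proof -
    have "cyclic_rel L x y z" using that unfolding cyclic_rel_def lt_def by blast
    then have "cyclic_rel L (\<phi> x) (\<phi> y) (\<phi> z)"
      using phi fld that unfolding cyclic_automorphism_def by blast
    then show ?thesis unfolding cyclic_rel_def lt_def by blast
  qed
  \<comment> \<open>For \<open>x < y < z\<close> with \<phi> inverting \<open>x\<close> and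
    \<open>y\<close>, the only cyclic pattern left is \<open>\<phi> y < \<phi> z < \<phi> x\<close>.
    Hence \<phi> inverts \<open>x\<close> and \<open>z\<close> too, while it keeps the order of
    \<open>y\<close> and \<open>z\<close>: this gives both that \<open>B\<close> is a final segment
    and that \<phi> is increasing on it.\<close>
  have up: "z \<in> B \<and> lt (\<phi> y) (\<phi> z)" if "y \<in> B" "lt y z" for y z
  proof -
    obtain x where x: "lt x y" "lt (\<phi> y) (\<phi> x)" using \<open>y \<in> B\<close> unfolding B_def by blast
    then have "lt (\<phi> y) (\<phi> z) \<and> lt (\<phi> z) (\<phi> x)"
      using cyc[OF x(1) that(2)] asym by blast
    moreover have "lt x z" using x that tr by blast
    ultimately show ?thesis unfolding B_def using fld by blast
  qed
  have monoA: "lt (\<phi> x) (\<phi> y)" if "x \<in> A" "y \<in> A" "lt x y" for x y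
  proof -
    have "\<not> lt (\<phi> y) (\<phi> x)" using that unfolding A_def B_def by blast
    moreover have "\<phi> x \<noteq> \<phi> y" using that inj fld irr by metis
    ultimately show ?thesis using tot phiF fld that by blast
  qed
  have AB: "lt x y" if "x \<in> A" "y \<in> B" for x y
    using that tot[of x y] up[of y x] AF BF unfolding A_def by blast
  \<comment> \<open>Otherwise take \<open>x < y\<close> inverted by \<phi>, so that
    \<open>\<phi> w < \<phi> y < \<phi> x\<close>. As \<open>w\<close> is not in \<open>B\<close>,
    it lies below \<open>x\<close>, and then \<open>w < x < y\<close> is sent to a triple of the
    opposite orientation.\<close>
  have BA: "lt (\<phi> y) (\<phi> w)" if w: "w \<in> A" and y: "y \<in> B" for w y
  proof (rule ccontr)
    assume "\<not> lt (\<phi> y) (\<phi> w)"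
    moreover have "\<phi> y \<noteq> \<phi> w" using w y inj AF BF AB irr by (metis subsetD)
    ultimately have wy: "lt (\<phi> w) (\<phi> y)" using tot phiF w y AF BF by blast
    obtain x where x: "lt x y" "lt (\<phi> y) (\<phi> x)" using y unfolding B_def by blast
    have wx: "lt (\<phi> w) (\<phi> x)" using wy x tr by blast
    then have "\<not> lt x w" using w unfolding A_def B_def by blast
    moreover have "w \<noteq> x" using wx irr by blast
    ultimately have "lt w x" using tot w AF fld(1)[OF x(1)] by blast
    from cyc[OF this x(1)] show False using wy x(2) asym by blast
  qed
  have im: "\<phi> ` A = Field L - \<phi> ` B" "\<phi> ` A \<subseteq> Field L" "\<phi> ` B \<subseteq> Field L"
    using bij BF phiF inj_on_image_set_diff[of \<phi> "Field L" "Field L" B]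
    unfolding A_def bij_betw_def by auto
  have "ordered_partition L A B"
    unfolding ordered_partition_def ofilter_def under_def
  proof (intro conjI ballI subsetI AF)
    fix x z assume x: "x \<in> A" and "z \<in> {z. (z, x) \<in> L}"
    then have zx: "(z, x) \<in> L" by simp
    show "z \<in> A"
    proof (rule ccontr)
      assume "z \<notin> A"
      then have "lt x z" using AB x zx unfolding A_def by (blast intro: FieldI1)
      then show False using zx Linear_order_antisym[OF L] unfolding lt_def by blast
    qed
  qed (use BF in \<open>auto simp: A_def\<close>)
  moreover have "ordered_partition L (\<phi> ` B) (\<phi> ` A)"
    unfolding ordered_partition_def ofilter_def under_def
  proof (intro conjI ballI subsetI im)
    fix u v assume u: "u \<in> \<phi> ` B" and "v \<in> {v. (v, u) \<in> L}"
    then have vu: "(v, u) \<in> L" by simp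
    show "v \<in> \<phi> ` B"
    proof (rule ccontr)
      assume "v \<notin> \<phi> ` B"
      then have "v \<in> \<phi> ` A" using im vu by (blast intro: FieldI1)
      then have "lt u v" using BA u by blast
      then show False using vu Linear_order_antisym[OF L] unfolding lt_def by blast
    qed
  qed (use im in auto)
  moreover have "iso (Restr L A) (Restr L (\<phi> ` A)) \<phi>"
  proof -
    have "(\<phi> x, \<phi> y) \<in> L" if "x \<in> A" "y \<in> A" "(x, y) \<in> L" for x y
      using monoA[of x y] that Linear_order_refl[OF L phiF] AF unfolding lt_def by blast
    then show ?thesis
      using iso_Restr_iff[OF L AF im(2)] bij_betw_subset[OF bij AF] by blast
  qed
  moreover have "iso (Restr L B) (Restr L (\<phi> ` B)) \<phi>"
  proof -
    have "(\<phi> x, \<phi> y) \<in> L" if "x \<in> B" "y \<in> B" "(x, y) \<in> L" for x y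
      using up[of x y] that Linear_order_refl[OF L phiF] BF unfolding lt_def by blast
    then show ?thesis
      using iso_Restr_iff[OF L BF im(3)] bij_betw_subset[OF bij BF] by blast
  qed
  ultimately show thesis by (rule that)
qed

section \<open>Lindenbaum's theorem for cones\<close>

text \<open>For a monotone \<open>f\<close> with \<open>a\<close> below \<open>f a\<close>, this is
  the convex hull of the forward orbit of \<open>a\<close>, the union of the intervals from
  \<open>a\<close> to its iterates. The inductive form gives the hull without iterating
  \<open>f\<close> and without a supremum, which may not exist.\<close>

inductive_set orbit_hull :: "'a rel \<Rightarrow> ('a \<Rightarrow> 'a) \<Rightarrow> 'a \<Rightarrow> 'a set"
  for L :: "'a rel" and f :: "'a \<Rightarrow> 'a" and a :: 'a where
  base: "a \<in> orbit_hull L f a"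
| step: "x \<in> orbit_hull L f a \<Longrightarrow> (a, z) \<in> L \<Longrightarrow> (z, f x) \<in> L \<Longrightarrow> z \<in> orbit_hull L f a"

text \<open>Lindenbaum's argument: apply \<open>f\<close> below the supremum of the orbit of \<open>a\<close> and the identity
  above it.\<close>

lemma cone_iso:
  assumes L: "Linear_order L"
    and B: "B \<subseteq> Field L" "\<And>x y. x \<in> B \<Longrightarrow> (x, y) \<in> L \<Longrightarrow> y \<in> B"
    and f: "\<And>x y. x \<in> B \<Longrightarrow> y \<in> B \<Longrightarrow> (x, y) \<in> L \<longleftrightarrow> (f x, f y) \<in> L"
    and im: "\<And>x y. x \<in> B \<Longrightarrow> (y, f x) \<in> L \<Longrightarrow> y \<in> f ` B"
    and a: "a \<in> B" "(a, f a) \<in> L"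
  obtains h where "bij_betw h (above L a) (above L (f a))"
    and "\<And>x y. (a, x) \<in> L \<Longrightarrow> (x, y) \<in> L \<Longrightarrow> (h x, h y) \<in> L" and "h a = f a"
proof -
  note tr = Linear_order_trans[OF L] and asym = Linear_order_antisym[OF L]
    and tot = Linear_order_total[OF L] and refl = Linear_order_refl[OF L]
  define C where "C = orbit_hull L f a"
  define h where "h x = (if x \<in> C then f x else x)" for x
  have aa: "(a, a) \<in> L" using refl a B by blast
  have inB: "x \<in> B" if "(a, x) \<in> L" for x using that a B by blast
  have CL: "(a, x) \<in> L" if "x \<in> C" for x
    using that unfolding C_def by (induction rule: orbit_hull.induct) (auto intro: aa)
  have fge: "(f a, f x) \<in> L" if "(a, x) \<in> L" for x using that f inB aa by blast
  have fge': "(a, f x) \<in> L" if "(a, x) \<in> L" for x using fge[OF that] a tr by blast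
  have Cinit: "x \<in> C" if "y \<in> C" "(a, x) \<in> L" "(x, y) \<in> L" for x y
    using that(1) unfolding C_def
  proof cases
    case base
    then have "x = a" using that asym by blast
    then show "x \<in> orbit_hull L f a" by (simp add: orbit_hull.base)
  next
    case (step w)
    then show "x \<in> orbit_hull L f a"
      using that tr by (blast intro: orbit_hull.step)
  qed
  have fC: "f x \<in> C" if "x \<in> C" for x
    using that CL fge' inB refl B unfolding C_def by (meson orbit_hull.step subsetD)
  have pre: "\<exists>w\<in>C. f w = z" if "z \<in> C" "(f a, z) \<in> L" for z
    using that(1) unfolding C_def
  proof cases
    case base
    then have "f a = z" using that a asym by blast
    then show "\<exists>w\<in>orbit_hull L f a. f w = z" using orbit_hull.base[of a L f] by blast
  next
    case (step x)
    then have x: "x \<in> B" "x \<in> C" using CL inB unfolding C_def by blast+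
    then obtain w where w: "w \<in> B" "z = f w" using im step by blast
    then have "(a, w) \<in> L" "(w, x) \<in> L" using f a x that step by auto
    then show "\<exists>w\<in>orbit_hull L f a. f w = z" using w Cinit x unfolding C_def by blast
  qed
  have mono: "(h x, h y) \<in> L" if "(a, x) \<in> L" "(x, y) \<in> L" for x y
  proof -
    have ay: "(a, y) \<in> L" using that tr by blast
    consider "y \<in> C" | "x \<in> C" "y \<notin> C" | "x \<notin> C" "y \<notin> C" by blast
    then show ?thesis
    proof cases
      case 1
      then have "x \<in> C" using Cinit that by blast
      then show ?thesis using 1 that ay f inB unfolding h_def by auto
    next
      case 2
      \<comment> \<open>The hull is an initial segment of the cone and closed under
        \<open>f\<close>, so \<open>f x\<close> cannot overtake a point outside it.\<close>
      then have "(y, f x) \<notin> L" using Cinit fC ay by blast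
      then have "(f x, y) \<in> L" using tot fge' that by (blast intro: FieldI2)
      then show ?thesis using 2 unfolding h_def by simp
    qed (use that in \<open>simp add: h_def\<close>)
  qed
  have inj: "x = y" if "(a, x) \<in> L" "(a, y) \<in> L" "h x = h y" for x y
  proof (cases "x \<in> C")
    case True
    then have "y \<in> C" using that fC unfolding h_def by (metis (full_types))
    then have "f x = f y" using that True unfolding h_def by simp
    moreover have "(f x, f x) \<in> L" using refl inB that f B by blast
    ultimately show ?thesis using f[of x y] f[of y x] inB that asym by auto
  next
    case False
    then have "y \<notin> C" using that fC unfolding h_def by (metis (full_types))
    then show ?thesis using that False unfolding h_def by simp
  qed
  have img: "h ` above L a = above L (f a)"
  proof (intro equalityI subsetI)
    fix z assume "z \<in> h ` above L a"
    then obtain x where x: "(a, x) \<in> L" "z = h x" unfolding above_def by blast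
    then have "(h a, h x) \<in> L" using mono aa by blast
    then show "z \<in> above L (f a)"
      using x unfolding above_def h_def C_def by (simp add: orbit_hull.base)
  next
    fix z assume z: "z \<in> above L (f a)"
    then have zL: "(f a, z) \<in> L" "(a, z) \<in> L" using a tr unfolding above_def by blast+
    show "z \<in> h ` above L a"
    proof (cases "z \<in> C")
      case True
      then obtain w where "w \<in> C" "f w = z" using pre zL by blast
      then have "z = h w" "w \<in> above L a" using CL unfolding h_def above_def by auto
      then show ?thesis by blast
    next
      case False
      then have "z = h z" "z \<in> above L a" using zL unfolding h_def above_def by auto
      then show ?thesis by blast
    qed
  qed
  show thesis
  proof
    show "bij_betw h (above L a) (above L (f a))"
      unfolding bij_betw_def inj_on_def using img inj by (simp add: above_def)
    show "h a = f a" unfolding h_def C_def by (simp add: orbit_hull.base)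
  qed (rule mono)
qed

section \<open>Order automorphisms from isomorphisms of a final onto an initial segment\<close>

text \<open>The hypotheses are self-dual: reversing \<open>L\<close> turns \<open>B'\<close> into a
  final and \<open>B\<close> into an initial segment, and the inverse of \<open>f\<close> moves
  \<open>f a\<close> to \<open>a\<close>, which is upwards in the reversed order. So the cone lemma
  applies on both sides of \<open>a\<close>, and the two isomorphisms are glued there.\<close>

lemma order_automorphism_of_segment_iso:
  assumes L: "Linear_order L"
    and p: "ordered_partition L A B" and q: "ordered_partition L B' A'"
    and f: "iso (Restr L B) (Restr L B') f"
    and a: "a \<in> B" "(a, f a) \<in> L"
  obtains H where "iso L L H" and "H a = f a"
proof -
  note tr = Linear_order_trans[OF L] and asym = Linear_order_antisym[OF L]
    and tot = Linear_order_total[OF L] and refl = Linear_order_refl[OF L]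
  note P = ordered_partition_props[OF L p] and Q = ordered_partition_props[OF L q]
  have sub: "B \<subseteq> Field L" "B' \<subseteq> Field L" using P(1) Q(1) by auto
  have bij: "bij_betw f B B'" using f iso_Restr_iff[OF L sub] by blast
  have f_iff: "(x, y) \<in> L \<longleftrightarrow> (f x, f y) \<in> L" if "x \<in> B" "y \<in> B" for x y
    using f that sub L bij unfolding iso_iff2
    by (auto simp: Field_Restr_Linear_order bij_betw_apply)
  have fB: "f ` B = B'" using bij by (simp add: bij_betw_def)
  have up: "y \<in> B" if "x \<in> B" "(x, y) \<in> L" for x y
    using that P by (metis FieldI2 UnE)
  have down: "y \<in> B'" if "x \<in> B'" "(y, x) \<in> L" for x y
    using that Q by (metis FieldI1 UnE)
  obtain h where h: "bij_betw h (above L a) (above L (f a))"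
    "\<And>x y. (a, x) \<in> L \<Longrightarrow> (x, y) \<in> L \<Longrightarrow> (h x, h y) \<in> L" "h a = f a"
  proof (rule cone_iso[OF L sub(1) up f_iff _ a])
    show "y \<in> f ` B" if "x \<in> B" "(y, f x) \<in> L" for x y
      using that down fB by blast
  qed auto
  define g where "g = inv_into B f"
  have g: "bij_betw g B' B" unfolding g_def using bij by (rule bij_betw_inv_into)
  have fg: "f (g y) = y" if "y \<in> B'" for y
    using that bij unfolding g_def by (simp add: bij_betw_inv_into_right)
  have gf: "g (f x) = x" if "x \<in> B" for x
    using that bij unfolding g_def by (simp add: bij_betw_inv_into_left)
  have gim: "g ` B' = B" using g by (simp add: bij_betw_def)
  have L': "Linear_order (L\<inverse>)" using L by simp
  have fa: "f a \<in> B'" using a fB by blast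
  obtain k where k: "bij_betw k (above (L\<inverse>) (f a)) (above (L\<inverse>) (g (f a)))"
    "\<And>x y. (f a, x) \<in> L\<inverse> \<Longrightarrow> (x, y) \<in> L\<inverse> \<Longrightarrow> (k x, k y) \<in> L\<inverse>" "k (f a) = g (f a)"
  proof (rule cone_iso[OF L', of B' g "f a"])
    show "(x, y) \<in> L\<inverse> \<longleftrightarrow> (g x, g y) \<in> L\<inverse>" if "x \<in> B'" "y \<in> B'" for x y
      using that f_iff[of "g y" "g x"] fg gim by auto
    show "y \<in> g ` B'" if "x \<in> B'" "(y, g x) \<in> L\<inverse>" for x y
      using that up gim by blast
    show "(f a, g (f a)) \<in> L\<inverse>" using a gf by simp
  qed (use sub down fa in auto)
  \<comment> \<open>In the reversed order \<open>above\<close> is \<open>under\<close>, so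
    \<open>k\<close> maps the points below \<open>f a\<close> onto those below \<open>a\<close>; its
    inverse has the direction required for gluing.\<close>
  define k' where "k' = inv_into (above (L\<inverse>) (f a)) k"
  have k': "bij_betw k' (under L a) (under L (f a))"
    using bij_betw_inv_into[OF k(1)] gf[OF a(1)] unfolding k'_def above_def under_def by simp
  have kk': "k (k' x) = x" if "(x, a) \<in> L" for x
    using bij_betw_inv_into_right[OF k(1)] gf[OF a(1)] that unfolding k'_def above_def by simp
  have k'F: "(k' x, f a) \<in> L" if "(x, a) \<in> L" for x
    using bij_betw_apply[OF k'] that unfolding under_def by blast
  have k'mono: "(k' x, k' y) \<in> L" if "(x, y) \<in> L" "(y, a) \<in> L" for x y
  proof (rule ccontr)
    have xa: "(x, a) \<in> L" using that tr by blast
    assume n: "(k' x, k' y) \<notin> L"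
    then have "(k' y, k' x) \<in> L" using tot k'F xa that by (blast intro: FieldI1)
    then have "(k (k' y), k (k' x)) \<in> L" using k(2) k'F xa that by blast
    then have "x = y" using kk' xa that asym by metis
    then show False using n refl k'F xa by (blast intro: FieldI1)
  qed
  have k'a: "k' a = f a"
  proof -
    have "f a \<in> above (L\<inverse>) (f a)" using refl a(2) by (auto simp: above_def intro: FieldI2)
    then show ?thesis
      using bij_betw_inv_into_left[OF k(1)] k(3) gf[OF a(1)] unfolding k'_def by metis
  qed
  have F: "a \<in> Field L" "f a \<in> Field L" using a(2) by (auto intro: FieldI1 FieldI2)
  define H where "H x = (if (a, x) \<in> L then h x else k' x)" for x
  \<comment> \<open>The two pieces overlap only at \<open>a\<close>, where both take the value
    \<open>f a\<close>.\<close>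
  have Hk: "H x = k' x" if "(x, a) \<in> L" for x
    using that asym h(3) k'a unfolding H_def by metis
  have Hh: "H x = h x" if "(a, x) \<in> L" for x using that unfolding H_def by simp
  have cover: "above L c \<union> under L c = Field L" if "c \<in> Field L" for c
    using tot[OF that] unfolding above_def under_def by (auto intro: FieldI1 FieldI2)
  have hup: "(f a, h x) \<in> L" if "(a, x) \<in> L" for x
    using bij_betw_apply[OF h(1)] that unfolding above_def by blast
  have img: "H ` Field L = Field L"
  proof -
    have "H ` above L a = above L (f a)"
      using h(1) image_cong[of "above L a" "above L a" H h] Hh
      unfolding bij_betw_def above_def by simp
    moreover have "H ` under L a = under L (f a)"
      using k' image_cong[of "under L a" "under L a" H k'] Hk
      unfolding bij_betw_def under_def by simp
    ultimately show ?thesis using cover[OF F(1)] cover[OF F(2)] by (metis image_Un)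
  qed
  have mono: "(H x, H y) \<in> L" if "(x, y) \<in> L" for x y
  proof -
    have xy: "x \<in> Field L" "y \<in> Field L" using that by (auto intro: FieldI1 FieldI2)
    consider "(a, x) \<in> L" | "(x, a) \<in> L" "(a, y) \<in> L" | "(y, a) \<in> L"
      using tot[OF F(1)] xy by blast
    then show ?thesis
    proof cases
      case 1
      then have "(a, y) \<in> L" using tr that by blast
      then show ?thesis using 1 that h(2) Hh by simp
    next
      case 2
      then show ?thesis using Hk Hh k'F hup tr by metis
    next
      case 3
      then have "(x, a) \<in> L" using tr that by blast
      then show ?thesis using 3 that k'mono Hk by simp
    qed
  qed
  have inj: "inj_on H (Field L)"
  proof -
    have "x = y" if "(x, y) \<in> L" "H x = H y" for x y
    proof -
      have xy: "x \<in> Field L" "y \<in> Field L" using that by (auto intro: FieldI1 FieldI2)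
      have h_inj: "u = v" if "h u = h v" "(a, u) \<in> L" "(a, v) \<in> L" for u v
        using h(1) that unfolding bij_betw_def inj_on_def above_def by blast
      have k'_inj: "u = v" if "k' u = k' v" "(u, a) \<in> L" "(v, a) \<in> L" for u v
        using k' that unfolding bij_betw_def inj_on_def under_def by blast
      have aa: "(a, a) \<in> L" using refl F by blast
      consider "(a, x) \<in> L" | "(x, a) \<in> L" "(a, y) \<in> L" | "(y, a) \<in> L"
        using tot[OF F(1)] xy by blast
      then show ?thesis
      proof cases
        case 1
        then have "(a, y) \<in> L" using tr that by blast
        then show ?thesis using 1 that h_inj Hh by metis
      next
        case 2
        then have "k' x = h y" using that Hk Hh by metis
        \<comment> \<open>The values of \<open>k'\<close> lie below \<open>f a\<close> and those of
          \<open>h\<close> above it, so a common value can only be \<open>f a\<close>.\<close>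
        then have "k' x = f a" "h y = f a" using k'F hup 2 asym by metis+
        then have "x = a" "y = a" using k'_inj h_inj k'a h(3) 2 aa by metis+
        then show ?thesis by simp
      next
        case 3
        then have "(x, a) \<in> L" using tr that by blast
        then show ?thesis using 3 that k'_inj Hk by metis
      qed
    qed
    then show ?thesis using tot unfolding inj_on_def by metis
  qed
  show thesis
  proof
    have "iso (Restr L (Field L)) (Restr L (Field L)) H"
      using iso_Restr_iff[OF L subset_refl subset_refl] inj img mono
      unfolding bij_betw_def by blast
    then show "iso L L H" by (simp add: Restr_Field)
    show "H a = f a" using Hh h(3) refl F by simp
  qed
qed

section \<open>Equivalence of the two notions of transitivity\<close>

theorem theorem4p6:
  fixes L :: "'a rel"
  assumes "Linear_order L"
  shows "cyclically_transitive L \<longleftrightarrow> transitive_cyclic_order (Field L) (cyclic_rel L)"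
proof
  assume ct: "cyclically_transitive L"
  have up: "\<exists>\<phi>. cyclic_automorphism (Field L) (cyclic_rel L) \<phi> \<and> \<phi> a = b"
    if ab: "(a, b) \<in> L" for a b
  proof -
    obtain L1 L2 L1' L2' F1 F2 where *: "ordered_partition L L1 L2" "ordered_partition L L2' L1'"
      "iso (Restr L L1) (Restr L L1') F1" "iso (Restr L L2) (Restr L L2') F2"
      and "a \<in> L1" "F1 a = b"
      using ct ab unfolding cyclically_transitive_def by blast
    then show ?thesis
      using cyclic_automorphism_rotation[OF assms *]
      by (intro exI[of _ "\<lambda>x. if x \<in> L1 then F1 x else F2 x"]) simp
  qed
  show "transitive_cyclic_order (Field L) (cyclic_rel L)"
    unfolding transitive_cyclic_order_def
  proof (intro ballI)
    fix a b assume F: "a \<in> Field L" "b \<in> Field L"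
    then consider "(a, b) \<in> L" | "(b, a) \<in> L" using Linear_order_total[OF assms] by blast
    then show "\<exists>\<phi>. cyclic_automorphism (Field L) (cyclic_rel L) \<phi> \<and> \<phi> a = b"
    proof cases
      case 1
      then show ?thesis by (rule up)
    next
      case 2
      then obtain \<phi> where phi: "cyclic_automorphism (Field L) (cyclic_rel L) \<phi>" "\<phi> b = a"
        using up by blast
      then have "inv_into (Field L) \<phi> a = b"
        using F unfolding cyclic_automorphism_def by (metis bij_betw_inv_into_left)
      with cyclic_automorphism_inv_into[OF phi(1)] show ?thesis by blast
    qed
  qed
next
  assume tc: "transitive_cyclic_order (Field L) (cyclic_rel L)"
  show "cyclically_transitive L"
    unfolding cyclically_transitive_def
  proof (intro allI impI)
    fix a b assume ab: "(a, b) \<in> L"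
    then have F: "a \<in> Field L" "b \<in> Field L" by (auto intro: FieldI1 FieldI2)
    then obtain \<phi> where phi: "cyclic_automorphism (Field L) (cyclic_rel L) \<phi>" "\<phi> a = b"
      using tc unfolding transitive_cyclic_order_def by blast
    obtain A B where cut: "ordered_partition L A B" "ordered_partition L (\<phi> ` B) (\<phi> ` A)"
      "iso (Restr L A) (Restr L (\<phi> ` A)) \<phi>" "iso (Restr L B) (Restr L (\<phi> ` B)) \<phi>"
      by (rule cyclic_automorphism_cut[OF assms phi(1)])
    show "\<exists>L1 L2 L1' L2' F1 F2.
        ordered_partition L L1 L2 \<and> ordered_partition L L2' L1' \<and>
        a \<in> L1 \<and> b \<in> L1' \<and>
        iso (Restr L L1) (Restr L L1') F1 \<and>
        iso (Restr L L2) (Restr L L2') F2 \<and>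
        F1 a = b"
    proof (cases "a \<in> A")
      case True
      then show ?thesis using cut phi(2) by blast
    next
      case False
      \<comment> \<open>Here the cut of \<phi> has \<open>a\<close> in the wrong block. It is
        replaced by the trivial rotation \<open>L + {} = {} + L\<close>, whose first isomorphism is
        an automorphism of \<open>L\<close>.\<close>
      then have "a \<in> B" using F ordered_partition_props(1)[OF assms cut(1)] by blast
      then obtain H where H: "iso L L H" "H a = b"
        using order_automorphism_of_segment_iso[OF assms cut(1,2,4)] ab phi(2) by metis
      have "ordered_partition L (Field L) {}" "ordered_partition L {} (Field L)"
        unfolding ordered_partition_def ofilter_def under_def by (auto intro: FieldI1)
      moreover have "iso (Restr L (Field L)) (Restr L (Field L)) H"
        using H(1) by (simp add: Restr_Field)
      moreover have "iso (Restr L {}) (Restr L {}) H"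
        by (simp add: iso_iff2 bij_betw_def)
      ultimately show ?thesis using F H(2) by blast
    qed
  qed
qed

end
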